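(* Let $\mathcal{R}$ be a finite chain ring with maximal ideal $\langle\gamma\rangle$, nilpotency index $s$ and residue field of size $q$. Let $n=q+1$ and let $\mathcal{C}\subseteq\mathcal{R}^n$ be an MHD code of rank $K=2$. Then $\mathcal{C}\subseteq\langle\gamma^{s-1}\rangle^n$.
   Context: $\mathcal{R}$ is a finite chain ring (not necessarily commutative) with maximal ideal $\langle\gamma\rangle=\gamma\mathcal{R}=\mathcal{R}\gamma$; $s$ is the nilpotency index of $\gamma$ (least positive integer with $\gamma^s=0$); $q$ is the size of the residue field $\mathcal{R}/\langle\gamma\rangle$. By convention $\gamma^0=1$. A linear code of length $n$ is a left $\mathcal{R}$-submodule $\mathcal{C}\subseteq\mathcal{R}^n$. Its rank $K$ is the minimal number of generators of $\mathcal{C}$. Homogeneous weight: put $M=\frac{q}{q-1}$. For $x\in\mathcal{R}$, $\mathrm{wt}_{\mathrm{Hom}}(x)=0$ if $x=0$, $=M$ if $x\in\langle\gamma^{s-1}\rangle\setminus\{0\}$, and $=1$ if $x\notin\langle\gamma^{s-1}\rangle$. For $x\in\mathcal{R}^n$, $\mathrm{wt}_{\mathrm{Hom}}(x)=\sum_{i=1}^n\mathrm{wt}_{\mathrm{Hom}}(x_i)$. For a linear code $\mathcal{C}\ne\{0\}$, $d_{\mathrm{Hom}}(\mathcal{C})=\min\{\mathrm{wt}_{\mathrm{Hom}}(c): c\in\mathcal{C}\setminus\{0\}\}$. A linear code $\mathcal{C}\subseteq\mathcal{R}^n$ of rank $K$ is a Maximum Homogeneous Distance (MHD) code if $d_{\mathrm{Hom}}(\mathcal{C})>M(n-K)$.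 *)

theory Defs
  imports "HOL-Analysis.Finite_Cartesian_Product" "HOL-Analysis.Cartesian_Space"
begin

definition left_ideal :: "'a::ring_1 set \<Rightarrow> bool" where
  "left_ideal I \<longleftrightarrow> 0 \<in> I \<and> (\<forall>x\<in>I. \<forall>y\<in>I. x + y \<in> I) \<and> (\<forall>r. \<forall>x\<in>I. r * x \<in> I)"

definition right_ideal :: "'a::ring_1 set \<Rightarrow> bool" where
  "right_ideal I \<longleftrightarrow> 0 \<in> I \<and> (\<forall>x\<in>I. \<forall>y\<in>I. x + y \<in> I) \<and> (\<forall>r. \<forall>x\<in>I. x * r \<in> I)"

definition two_sided_ideal :: "'a::ring_1 set \<Rightarrow> bool" where
  "two_sided_ideal I \<longleftrightarrow> left_ideal I \<and> right_ideal I"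

definition maximal_ideal :: "'a::ring_1 set \<Rightarrow> bool" where
  "maximal_ideal I \<longleftrightarrow> two_sided_ideal I \<and> I \<noteq> UNIV \<and>
     (\<forall>J. two_sided_ideal J \<longrightarrow> I \<subseteq> J \<longrightarrow> J = I \<or> J = UNIV)"

definition principal_ideal :: "'a::ring_1 \<Rightarrow> 'a set" where
  "principal_ideal x = two_sided_ideal hull {x}"

(* A chain ring need not be commutative: both one-sided ideal lattices are required to be
   chains.  For finite rings either condition implies the other. *)
definition chain_ring :: "'a::ring_1 itself \<Rightarrow> bool" where
  "chain_ring _ \<longleftrightarrow> chain_subset {I :: 'a set. left_ideal I} \<and> chain_subset {I :: 'a set. right_ideal I}"

definition chain_ring_generator :: "'a::ring_1 \<Rightarrow> bool" where
  "chain_ring_generator \<gamma> \<longleftrightarrow>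
     maximal_ideal (principal_ideal \<gamma>) \<and>
     principal_ideal \<gamma> = range (\<lambda>r. \<gamma> * r) \<and>
     principal_ideal \<gamma> = range (\<lambda>r. r * \<gamma>)"

(* In a finite chain ring a generator of the maximal ideal is nilpotent, so the least element
   exists; it is 1 (with \<gamma> = 0 and \<gamma> ^ 0 = 1) exactly when the ring is a field. *)
definition nilpotency_index :: "'a::ring_1 \<Rightarrow> nat" where
  "nilpotency_index \<gamma> = (LEAST k. 0 < k \<and> \<gamma> ^ k = 0)"

definition residue_card :: "'a::ring_1 \<Rightarrow> nat" where
  "residue_card \<gamma> = card ((UNIV :: 'a set) // {(x, y). x - y \<in> principal_ideal \<gamma>})"

(* The module of all n-tuples is the type of vectors indexed by 'n with n = CARD('n), and the
   operation *s multiplies every component by the scalar from the left. *)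
definition linear_code :: "('a::ring_1 ^ 'n) set \<Rightarrow> bool" where
  "linear_code C \<longleftrightarrow> 0 \<in> C \<and> (\<forall>x\<in>C. \<forall>y\<in>C. x + y \<in> C) \<and> (\<forall>r. \<forall>x\<in>C. r *s x \<in> C)"

definition code_rank :: "('a::ring_1 ^ 'n) set \<Rightarrow> nat" where
  "code_rank C = (LEAST k. \<exists>G. finite G \<and> card G = k \<and> linear_code hull G = C)"

definition hom_M :: "'a::ring_1 \<Rightarrow> real" where
  "hom_M \<gamma> = real (residue_card \<gamma>) / (real (residue_card \<gamma>) - 1)"

definition wt_Hom_elem :: "'a::ring_1 \<Rightarrow> 'a \<Rightarrow> real" where
  "wt_Hom_elem \<gamma> x =
     (if x = 0 then 0
      else if x \<in> principal_ideal (\<gamma> ^ (nilpotency_index \<gamma> - 1)) then hom_M \<gamma>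
      else 1)"

definition wt_Hom :: "'a::ring_1 \<Rightarrow> 'a ^ 'n \<Rightarrow> real" where
  "wt_Hom \<gamma> x = (\<Sum>i\<in>UNIV. wt_Hom_elem \<gamma> (x $ i))"

(* Only meaningful for a finite ring and C different from {0}. *)
definition d_Hom :: "'a::ring_1 \<Rightarrow> ('a ^ 'n) set \<Rightarrow> real" where
  "d_Hom \<gamma> C = Min (wt_Hom \<gamma> ` (C - {0}))"

definition MHD_code :: "'a::ring_1 \<Rightarrow> ('a ^ 'n) set \<Rightarrow> bool" where
  "MHD_code \<gamma> C \<longleftrightarrow> linear_code C \<and> C \<noteq> {0} \<and>
     d_Hom \<gamma> C > hom_M \<gamma> * (real CARD('n) - real (code_rank C))"

end

theory Submission
  imports Defs
begin

text \<open>
  Let \<open>S\<close> be the set of codewords killed by \<open>\<gamma>\<close>; these are the codewords with all entries in the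
  socle \<open>\<langle>\<gamma>^(s-1)\<rangle>\<close>, which has at most \<open>q\<close> elements. Left multiplication by \<open>\<gamma>\<close> is additive on
  \<open>C\<close> with kernel \<open>S\<close>, so \<open>S\<close> has as many elements as \<open>C/\<gamma>C\<close>, and by Nakayama's lemma
  these are at least \<open>q^2\<close>. The distance bound says that a nonzero word of \<open>S\<close> has at most one zero
  entry; counting then forces every coordinate to map \<open>S\<close> onto the socle, and every word of \<open>S\<close> to
  have a zero entry. If \<open>C\<close> were not contained in the socle, some \<open>c\<close> in \<open>C\<close> would satisfy
  \<open>\<gamma>c \<noteq> 0 = \<gamma>^2 c\<close>. The word \<open>\<gamma>c\<close> vanishes at exactly one position \<open>i\<close>, and adding to \<open>c\<close> a word
  of \<open>S\<close> with \<open>i\<close>-th entry \<open>-c_i\<close> produces a codeword with one zero entry and all other entries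
  outside the socle. Its weight is \<open>q\<close>, which violates the distance bound.
\<close>

section \<open>Counting in finite groups and one-sided inverses in finite rings\<close>

text \<open>Every fibre over the image is a translate of the kernel. Closure under differences makes
  \<open>A\<close> a subgroup unless it is empty.\<close>

lemma card_image_times_card_kernel:
  fixes f :: "'a::ab_group_add \<Rightarrow> 'b::ab_group_add"
  assumes "finite A" and "\<And>x y. x \<in> A \<Longrightarrow> y \<in> A \<Longrightarrow> x - y \<in> A"
    and add: "\<And>x y. f (x + y) = f x + f y"
  shows "card A = card (f ` A) * card {x \<in> A. f x = 0}"
proof -
  interpret additive f by unfold_locales (rule add)
  have fibre: "card {x \<in> A. f x = y} = card {x \<in> A. f x = 0}" if y: "y \<in> f ` A" for y
  proof -
    obtain a where a: "a \<in> A" "f a = y" using y by blast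
    \<comment> \<open>Only differences are available, so the sum is written as
      \<open>x - ((a - a) - a)\<close>.\<close>
    have "x + a \<in> A" if "x \<in> A" for x
      using assms(2)[OF that assms(2)[OF assms(2)[OF a(1) a(1)] a(1)]] by simp
    then have "bij_betw (\<lambda>x. x + a) {x \<in> A. f x = 0} {x \<in> A. f x = y}"
      by (intro bij_betw_byWitness[where f' = "\<lambda>x. x - a"]) (use a assms(2) in \<open>auto simp: add diff\<close>)
    then show ?thesis by (simp add: bij_betw_same_card)
  qed
  have "card A = (\<Sum>y\<in>f ` A. card {x \<in> A. f x = y})"
    using sum.image_gen[OF \<open>finite A\<close>, of "\<lambda>_. 1::nat" f] by simp
  then show ?thesis by (simp add: fibre)
qed

text \<open>Right multiplication by \<open>x\<close> is injective, hence surjective by finiteness.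
  This gives a left inverse of \<open>x\<close>, which must coincide with \<open>y\<close>.\<close>

lemma finite_ring_left_inverse:
  fixes x y :: "'a::{ring_1, finite}"
  assumes "x * y = 1"
  shows "y * x = 1"
proof -
  have "inj (\<lambda>z. z * x)"
    by (rule injI) (metis assms mult.assoc mult_1_right)
  then obtain z where "z * x = 1"
    by (metis finite_UNIV_inj_surj finite surjD)
  then show ?thesis
    by (metis assms mult.assoc mult_1_left mult_1_right)
qed

section \<open>Finite chain rings\<close>

locale finite_chain_ring =
  fixes \<gamma> :: "'a::{ring_1, finite}"
  assumes chain: "chain_ring TYPE('a)" and gen: "chain_ring_generator \<gamma>"
begin

abbreviation "P \<equiv> principal_ideal \<gamma>"
abbreviation "s \<equiv> nilpotency_index \<gamma>"
abbreviation "q \<equiv> residue_card \<gamma>"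

lemma P_eq_left: "P = range (\<lambda>r. \<gamma> * r)" and P_eq_right: "P = range (\<lambda>r. r * \<gamma>)"
  and maximal_P: "maximal_ideal P"
  using gen by (auto simp: chain_ring_generator_def)

lemma one_notin_P: "1 \<notin> P"
proof
  assume "1 \<in> P"
  then have "r \<in> P" for r
    using maximal_P unfolding maximal_ideal_def two_sided_ideal_def left_ideal_def
    by (metis mult_1_right)
  then show False using maximal_P unfolding maximal_ideal_def by blast
qed

lemma P_add: "x \<in> P \<Longrightarrow> y \<in> P \<Longrightarrow> x + y \<in> P"
  and P_lmult: "x \<in> P \<Longrightarrow> r * x \<in> P"
  and P_zero: "0 \<in> P"
  using maximal_P unfolding maximal_ideal_def two_sided_ideal_def left_ideal_def by auto

lemma P_uminus: "x \<in> P \<Longrightarrow> - x \<in> P"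
  using P_lmult[of x "-1"] by simp

lemma P_diff: "x \<in> P \<Longrightarrow> y \<in> P \<Longrightarrow> x - y \<in> P"
  using P_add[of x "- y"] P_uminus by simp

lemma left_multiples_chain:
  fixes x y :: 'a
  shows "(\<exists>r. x = r * y) \<or> (\<exists>r. y = r * x)"
proof -
  have I: "left_ideal (range (\<lambda>r. r * z))" for z :: 'a
    unfolding left_ideal_def
    by (auto simp flip: mult.assoc distrib_right intro: range_eqI[of _ _ 0])
  have mem: "z \<in> range (\<lambda>r. r * z)" for z :: 'a
    by (rule range_eqI[of _ _ 1]) simp
  have "range (\<lambda>r. r * x) \<subseteq> range (\<lambda>r. r * y) \<or> range (\<lambda>r. r * y) \<subseteq> range (\<lambda>r. r * x)"
    using chain I[of x] I[of y] unfolding chain_ring_def chain_subset_def by simp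
  then have "x \<in> range (\<lambda>r. r * y) \<or> y \<in> range (\<lambda>r. r * x)"
    using mem[of x] mem[of y] by (elim disjE) (auto dest: subsetD)
  then show ?thesis by (auto simp: image_iff)
qed

text \<open>The non-units form a two-sided ideal, because the ring is finite and a chain ring; by
  maximality this ideal is \<open>P\<close>.\<close>

lemma left_inverse_of_notin_P:
  assumes "x \<notin> P"
  obtains y where "y * x = 1"
proof -
  define J where "J = {x :: 'a. \<forall>y. y * x \<noteq> 1}"
  have mult: "r * x \<in> J" if "x \<in> J" for r x
    using that by (simp add: J_def flip: mult.assoc)
  \<comment> \<open>Passing twice between left and right inverses turns a left inverse of
    \<open>x * r\<close> into one of \<open>x\<close>.\<close>
  have "x * r \<in> J" if "x \<in> J" for r x
  proof -
    have "y * (x * r) \<noteq> 1" for y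
    proof
      assume "y * (x * r) = 1"
      then have "x * r * y = 1" by (rule finite_ring_left_inverse)
      then have "x * (r * y) = 1" by (simp add: mult.assoc)
      then have "r * y * x = 1" by (rule finite_ring_left_inverse)
      with that show False by (simp add: J_def)
    qed
    then show ?thesis by (simp add: J_def)
  qed
  \<comment> \<open>The chain condition enters here: one summand is a left multiple of the other, so
    the sum is a left multiple of a single element of \<open>J\<close>.\<close>
  moreover have "x + y \<in> J" if "x \<in> J" "y \<in> J" for x y
    using left_multiples_chain[of x y]
  proof (elim disjE exE)
    fix r assume "x = r * y"
    then show ?thesis using mult[OF that(2), of "r + 1"] by (simp add: distrib_right)
  next
    fix r assume "y = r * x"
    then show ?thesis using mult[OF that(1), of "1 + r"] by (simp add: distrib_right)
  qed
  moreover have "0 \<in> J" by (simp add: J_def)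
  ultimately have "two_sided_ideal J"
    using mult by (simp add: two_sided_ideal_def left_ideal_def right_ideal_def)
  moreover have "P \<subseteq> J"
  proof
    fix x assume "x \<in> P"
    then have "y * x \<noteq> 1" for y using P_lmult[of x y] one_notin_P by auto
    then show "x \<in> J" by (simp add: J_def)
  qed
  moreover have "J \<noteq> UNIV" unfolding J_def using mult_1_left[of "1::'a"] by blast
  ultimately have "J = P" using maximal_P unfolding maximal_ideal_def by blast
  then show thesis using assms that by (auto simp: J_def)
qed

lemma right_cancel_zero:
  assumes "x \<notin> P" and "z * x = 0"
  shows "z = 0"
proof -
  obtain y where "y * x = 1" using left_inverse_of_notin_P assms(1) .
  then have "x * y = 1" by (rule finite_ring_left_inverse)
  then show ?thesis by (metis assms(2) mult.assoc mult_1_right mult_zero_left)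
qed

section \<open>Powers of \<gamma> and the socle\<close>

text \<open>By finiteness two powers of \<gamma> agree, so some \<open>\<gamma> ^ m\<close> is
  killed by a factor \<open>1 - \<gamma> ^ Suc k\<close>. That factor lies outside \<open>P\<close>
  and can be cancelled.\<close>

lemma nilpotent: "\<exists>k>0. \<gamma> ^ k = 0"
proof -
  have "\<not> inj (\<lambda>k. \<gamma> ^ k)"
    using finite_imageD[of "\<lambda>k::nat. \<gamma> ^ k" UNIV] by auto
  then obtain m n :: nat where "m < n" "\<gamma> ^ m = \<gamma> ^ n"
    by (metis injI linorder_neqE_nat)
  then obtain k where k: "\<gamma> ^ m = \<gamma> ^ (m + Suc k)"
    using less_iff_Suc_add[of m n] by auto
  have "\<gamma> ^ Suc k \<in> P" by (auto simp: P_eq_left)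
  then have "1 - \<gamma> ^ Suc k \<notin> P"
    using P_add[of "1 - \<gamma> ^ Suc k" "\<gamma> ^ Suc k"] one_notin_P by auto
  moreover have "\<gamma> ^ m * (1 - \<gamma> ^ Suc k) = 0"
    using k by (simp only: right_diff_distrib power_add mult_1_right) simp
  ultimately have "\<gamma> ^ m = 0" by (rule right_cancel_zero)
  then show ?thesis by (intro exI[of _ "Suc m"]) simp
qed

lemma s_pos: "0 < s" and power_s: "\<gamma> ^ s = 0"
  using LeastI_ex[OF nilpotent] unfolding nilpotency_index_def by auto

lemma s_le: "0 < k \<Longrightarrow> \<gamma> ^ k = 0 \<Longrightarrow> s \<le> k"
  unfolding nilpotency_index_def by (rule Least_le) simp

text \<open>A substitute for commutativity: left and right multiples of \<gamma> form the same set
  \<open>P\<close>, so \<gamma> moves past \<open>r\<close> at the price of changing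
  \<open>r\<close>.\<close>

lemma gamma_commute: "\<exists>r'. r * \<gamma> = \<gamma> * r'"
proof -
  have "r * \<gamma> \<in> P" by (auto simp: P_eq_right)
  then show ?thesis by (auto simp: P_eq_left)
qed

lemma power_gamma_commute: "\<exists>r'. r * \<gamma> ^ k = \<gamma> ^ k * r'"
proof (induction k arbitrary: r)
  case (Suc k)
  obtain r1 where r1: "r * \<gamma> = \<gamma> * r1" using gamma_commute by blast
  obtain r2 where r2: "r1 * \<gamma> ^ k = \<gamma> ^ k * r2" using Suc.IH by blast
  have "r * \<gamma> ^ Suc k = \<gamma> * (r1 * \<gamma> ^ k)"
    using r1 by (simp flip: mult.assoc)
  also have "\<dots> = \<gamma> ^ Suc k * r2"
    using r2 by (simp add: mult.assoc)
  finally show ?case by blast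
qed auto

text \<open>Since \<open>\<gamma> ^ k\<close> can be moved past scalars, its right multiples already
  form a two-sided ideal.\<close>

lemma principal_ideal_power: "principal_ideal (\<gamma> ^ k) = range (\<lambda>r. \<gamma> ^ k * r)"
proof
  define I where "I = range (\<lambda>r. \<gamma> ^ k * r)"
  have "0 \<in> I" unfolding I_def by (rule range_eqI[of _ _ 0]) simp
  moreover have "x + y \<in> I" if "x \<in> I" "y \<in> I" for x y
    using that by (auto simp: I_def simp flip: distrib_left)
  moreover have "r * x \<in> I" if x: "x \<in> I" for x r
  proof -
    obtain z where z: "x = \<gamma> ^ k * z" using x by (auto simp: I_def)
    obtain r' where "r * \<gamma> ^ k = \<gamma> ^ k * r'" using power_gamma_commute by blast
    then have "r * x = \<gamma> ^ k * (r' * z)" using z by (simp flip: mult.assoc)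
    then show ?thesis by (simp add: I_def)
  qed
  moreover have "x * r \<in> I" if "x \<in> I" for x r
    using that by (auto simp: I_def mult.assoc)
  ultimately have "two_sided_ideal (range (\<lambda>r. \<gamma> ^ k * r))"
    unfolding two_sided_ideal_def left_ideal_def right_ideal_def I_def by blast
  moreover have "\<gamma> ^ k \<in> range (\<lambda>r. \<gamma> ^ k * r)" by (rule range_eqI[of _ _ 1]) simp
  ultimately show "principal_ideal (\<gamma> ^ k) \<subseteq> range (\<lambda>r. \<gamma> ^ k * r)"
    unfolding principal_ideal_def by (intro hull_minimal) auto
  show "range (\<lambda>r. \<gamma> ^ k * r) \<subseteq> principal_ideal (\<gamma> ^ k)"
    unfolding principal_ideal_def hull_def two_sided_ideal_def right_ideal_def by auto
qed

text \<open>Some \<open>k\<close> has \<open>x\<close> a right multiple of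
  \<open>\<gamma> ^ k\<close> but not of \<open>\<gamma> ^ Suc k\<close>, because \<open>x\<close>
  is a multiple of \<open>\<gamma> ^ 0\<close> but not of \<open>\<gamma> ^ s = 0\<close>. A
  cofactor in \<open>P\<close> would release a further \<gamma>.\<close>

lemma eq_power_times_unit:
  assumes "x \<noteq> 0"
  obtains k u where "x = \<gamma> ^ k * u" "u \<notin> P"
proof -
  have "\<exists>u k. x = \<gamma> ^ k * u \<and> u \<notin> P" if "\<nexists>u. x = \<gamma> ^ n * u" for n
    using that
  proof (induction n)
    case (Suc n)
    show ?case
    proof (cases "\<exists>u. x = \<gamma> ^ n * u")
      case True
      then obtain u where u: "x = \<gamma> ^ n * u" by blast
      moreover have "u \<notin> P"
        using Suc.prems u by (auto simp: P_eq_left power_Suc2 mult.assoc simp del: power_Suc)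
      ultimately show ?thesis by blast
    qed (use Suc.IH in blast)
  qed simp
  from this[of s] that show thesis using assms by (auto simp: power_s)
qed

text \<open>Turns the ideal in the weight into the kernel of left multiplication by \<gamma>. For
  the converse, write \<open>x = \<gamma> ^ k * u\<close> and cancel \<open>u\<close>: then
  \<open>\<gamma> ^ Suc k = 0\<close>, which forces \<open>k \<ge> s - 1\<close>.\<close>

lemma socle_iff: "x \<in> principal_ideal (\<gamma> ^ (s - 1)) \<longleftrightarrow> \<gamma> * x = 0"
proof
  assume "x \<in> principal_ideal (\<gamma> ^ (s - 1))"
  then obtain r where "x = \<gamma> ^ (s - 1) * r" by (auto simp: principal_ideal_power)
  moreover have "\<gamma> * \<gamma> ^ (s - 1) = 0"
    using power_s s_pos by (metis power_eq_if not_gr_zero)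
  ultimately show "\<gamma> * x = 0" by (simp flip: mult.assoc)
next
  assume gx: "\<gamma> * x = 0"
  show "x \<in> principal_ideal (\<gamma> ^ (s - 1))"
  proof (cases "x = 0")
    case True
    then show ?thesis by (auto simp: principal_ideal_power intro: range_eqI[of _ _ 0])
  next
    case False
    then obtain k u where k: "x = \<gamma> ^ k * u" "u \<notin> P" by (rule eq_power_times_unit)
    with gx have "\<gamma> ^ Suc k * u = 0" by (simp add: mult.assoc)
    then have "\<gamma> ^ Suc k = 0" using right_cancel_zero k(2) by blast
    then have "s \<le> Suc k" using s_le by blast
    then have "\<gamma> ^ k = \<gamma> ^ (s - 1) * \<gamma> ^ (k - (s - 1))" by (simp flip: power_add)
    then show ?thesis using k by (auto simp: principal_ideal_power mult.assoc)
  qed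
qed

section \<open>Representatives of the residue field and the size of the socle\<close>

text \<open>One representative per class modulo \<open>P\<close>, so that \<open>q\<close> can be
  used for counting ring elements instead of classes.\<close>

lemma residue_system:
  obtains T where "card T = q" "\<And>r. \<exists>t\<in>T. r - t \<in> P"
    "\<And>t t'. t \<in> T \<Longrightarrow> t' \<in> T \<Longrightarrow> t - t' \<in> P \<Longrightarrow> t = t'"
proof -
  define E where "E = {(x, y). x - y \<in> P}"
  have E: "equiv UNIV E"
  proof (rule equivI)
    show "refl E" by (auto simp: refl_on_def E_def P_zero)
    show "sym E" unfolding sym_def E_def using P_uminus by force
    show "trans E" unfolding trans_def E_def using P_add by fastforce
  qed auto
  define f where "f X = (SOME x. x \<in> X)" for X :: "'a set"
  have f: "f X \<in> X" if "X \<in> UNIV // E" for X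
    unfolding f_def using in_quotient_imp_non_empty[OF E that] by (simp add: some_in_eq)
  have same: "X = Y" if "X \<in> UNIV // E" "Y \<in> UNIV // E" "f X - f Y \<in> P" for X Y
    using quotient_eq_iff[OF E that(1,2) f[OF that(1)] f[OF that(2)]] that(3) by (simp add: E_def)
  have "inj_on f (UNIV // E)" by (intro inj_onI same) (auto simp: P_zero)
  then have "card (f ` (UNIV // E)) = q"
    by (simp add: card_image residue_card_def E_def)
  moreover have "\<exists>t\<in>f ` (UNIV // E). r - t \<in> P" for r
  proof (rule bexI)
    show "f (E `` {r}) \<in> f ` (UNIV // E)" by (auto intro: quotientI)
    show "r - f (E `` {r}) \<in> P" using f[OF quotientI[of r UNIV E]] by (auto simp: E_def)
  qed
  moreover have "t = t'" if "t \<in> f ` (UNIV // E)" "t' \<in> f ` (UNIV // E)" "t - t' \<in> P" for t t'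
    using that same by blast
  ultimately show thesis by (rule that)
qed

lemma q_ge_2: "2 \<le> q"
proof -
  obtain T where T: "card T = q" "\<And>r. \<exists>t\<in>T. r - t \<in> P"
    by (rule residue_system) blast
  obtain a b where ab: "a \<in> T" "b \<in> T" "0 - a \<in> P" "1 - b \<in> P"
    using T(2) by blast
  then have "a \<noteq> b" using P_diff[OF ab(4,3)] one_notin_P by auto
  then have "card {a, b} = 2" by simp
  moreover have "card {a, b} \<le> card T" using ab by (intro card_mono) auto
  ultimately show ?thesis using T(1) by simp
qed

text \<open>The product \<open>\<gamma> ^ (s - 1) * r\<close> depends only on \<open>r\<close>
  modulo \<open>P\<close>.\<close>

lemma card_socle_le: "card {x :: 'a. \<gamma> * x = 0} \<le> q"
proof -
  obtain T where T: "card T = q" "\<And>r. \<exists>t\<in>T. r - t \<in> P"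
    by (rule residue_system) blast
  have "{x. \<gamma> * x = 0} \<subseteq> (\<lambda>t. \<gamma> ^ (s - 1) * t) ` T"
  proof
    fix x assume "x \<in> {x. \<gamma> * x = 0}"
    then obtain r where r: "x = \<gamma> ^ (s - 1) * r"
      using socle_iff by (auto simp: principal_ideal_power)
    obtain t where t: "t \<in> T" "r - t \<in> P" using T(2) by blast
    then obtain z where "r - t = \<gamma> * z" by (auto simp: P_eq_left)
    then have "\<gamma> ^ (s - 1) * (r - t) = \<gamma> ^ Suc (s - 1) * z"
      by (metis mult.assoc power_Suc2)
    also have "\<dots> = 0" using s_pos power_s by simp
    finally show "x \<in> (\<lambda>t. \<gamma> ^ (s - 1) * t) ` T" using r t(1) by (auto simp: right_diff_distrib)
  qed
  then have "card {x. \<gamma> * x = 0} \<le> card ((\<lambda>t. \<gamma> ^ (s - 1) * t) ` T)" by (intro card_mono) auto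
  also have "\<dots> \<le> q" using T(1) card_image_le[of T] by (metis finite)
  finally show ?thesis .
qed

section \<open>Codes of rank two\<close>

text \<open>Substituting the decomposition into its own remainder \<open>k\<close> times leaves a
  remainder in \<open>\<gamma> ^ k *s C\<close>, which vanishes at \<open>k = s\<close>.\<close>

lemma nakayama:
  fixes C N :: "('a ^ 'n) set"
  assumes N: "linear_code N" and gen: "\<And>c. c \<in> C \<Longrightarrow> \<exists>x\<in>N. \<exists>d\<in>C. c = x + \<gamma> *s d"
  shows "C \<subseteq> N"
proof
  fix c assume c: "c \<in> C"
  have "\<exists>x\<in>N. \<exists>d\<in>C. c = x + \<gamma> ^ k *s d" for k
  proof (induction k)
    case 0
    show ?case using c N by (intro bexI[of _ 0] bexI[of _ c]) (auto simp: linear_code_def)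
  next
    case (Suc k)
    then obtain x d where x: "x \<in> N" "d \<in> C" "c = x + \<gamma> ^ k *s d" by blast
    obtain y e where y: "y \<in> N" "e \<in> C" "d = y + \<gamma> *s e" using gen[OF x(2)] by blast
    have "x + \<gamma> ^ k *s y \<in> N" using N x(1) y(1) by (auto simp: linear_code_def)
    moreover have "c = (x + \<gamma> ^ k *s y) + \<gamma> ^ Suc k *s e"
      using x(3) y(3) by (simp add: vec_eq_iff algebra_simps power_Suc2 del: power_Suc)
    ultimately show ?case using y(2) by blast
  qed
  from this[of s] show "c \<in> N" by (auto simp: power_s)
qed

text \<open>With \<open>D\<close> for \<gamma>C, find \<open>x\<close> outside \<open>D\<close> and
  \<open>y\<close> outside Rx + \<open>D\<close>. The words \<open>a *s x + b *s y + d\<close>, with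
  \<open>a\<close>, \<open>b\<close> residue representatives and \<open>d\<close> in
  \<open>D\<close>, are distinct, so \<open>q\<^sup>2 * card D \<le> card C\<close>.\<close>

lemma card_kernel_ge:
  fixes C :: "('a ^ 'n) set"
  assumes C: "linear_code C" "C \<noteq> {0}" and rank: "code_rank C = 2"
  shows "q\<^sup>2 \<le> card {c \<in> C. \<gamma> *s c = 0}"
proof -
  have C0: "0 \<in> C" and Cadd: "\<And>x y. x \<in> C \<Longrightarrow> y \<in> C \<Longrightarrow> x + y \<in> C"
    and Csm: "\<And>r x. x \<in> C \<Longrightarrow> r *s x \<in> C"
    using C(1) by (auto simp: linear_code_def)
  define D where "D = (\<lambda>c. \<gamma> *s c) ` C"
  have DC: "D \<subseteq> C" using Csm by (auto simp: D_def)
  have D: "linear_code D"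
    unfolding linear_code_def
  proof (intro conjI ballI allI)
    show "0 \<in> D" using C0 by (force simp: D_def)
    show "x + y \<in> D" if "x \<in> D" "y \<in> D" for x y
      using that Cadd unfolding D_def by (auto simp flip: vector_add_ldistrib)
    show "r *s x \<in> D" if x: "x \<in> D" for r x
    proof -
      obtain c where c: "c \<in> C" "x = \<gamma> *s c" using x by (auto simp: D_def)
      obtain r' where "r * \<gamma> = \<gamma> * r'" using gamma_commute by blast
      then have "r *s x = \<gamma> *s (r' *s c)" using c by (simp add: vector_smult_assoc)
      then show ?thesis using c(1) Csm by (auto simp: D_def)
    qed
  qed
  have Dadd: "\<And>x y. x \<in> D \<Longrightarrow> y \<in> D \<Longrightarrow> x + y \<in> D" and Dsm: "\<And>r x. x \<in> D \<Longrightarrow> r *s x \<in> D"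
    using D by (auto simp: linear_code_def)
  have Ddiff: "x - y \<in> D" if "x \<in> D" "y \<in> D" for x y
    using Dadd[OF that(1) Dsm[OF that(2), of "-1"]] by (simp flip: vector_sneg_minus1)

  obtain x where x: "x \<in> C" "x \<notin> D"
  proof -
    have "\<not> C \<subseteq> {0}" using C C0 by blast
    moreover have "linear_code ({0} :: ('a ^ 'n) set)" by (simp add: linear_code_def)
    ultimately have "\<not> C \<subseteq> D" using nakayama[of "{0}" C] by (auto simp: D_def)
    then show thesis using that by blast
  qed
  define N where "N = range (\<lambda>r. r *s x)"
  have N: "linear_code N"
    unfolding linear_code_def N_def
    by (auto simp: vector_smult_assoc simp flip: vector_sadd_rdistrib intro: range_eqI[of _ _ 0])
  have "x \<in> N" unfolding N_def by (rule range_eqI[of _ _ 1]) simp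
  then have "linear_code hull {x} = N"
    by (intro hull_unique) (use N in \<open>auto simp: N_def linear_code_def\<close>)
  \<comment> \<open>Rank two enters here: one generator does not suffice, so Nakayama with
    \<open>N\<close> = Rx provides \<open>y\<close>.\<close>
  moreover have "linear_code hull {x} \<noteq> C"
  proof
    assume "linear_code hull {x} = C"
    then have "code_rank C \<le> 1"
      unfolding code_rank_def by (intro Least_le exI[of _ "{x}"]) simp
    with rank show False by simp
  qed
  ultimately have "N \<noteq> C" by simp
  moreover have "N \<subseteq> C" using x(1) Csm by (auto simp: N_def)
  ultimately have "\<not> C \<subseteq> N" by blast
  then obtain y where y: "y \<in> C" "\<not> (\<exists>n\<in>N. \<exists>d\<in>C. y = n + \<gamma> *s d)"
    using nakayama[OF N] by blast
  have y_neq: "y \<noteq> r *s x + d" if "d \<in> D" for r d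
    using y(2) that by (auto simp: N_def D_def)

  obtain T where T: "card T = q" "\<And>t t'. t \<in> T \<Longrightarrow> t' \<in> T \<Longrightarrow> t - t' \<in> P \<Longrightarrow> t = t'"
    by (rule residue_system) blast
  \<comment> \<open>A coefficient outside \<open>P\<close> could be inverted, making
    \<open>z\<close> a multiple of \<open>w\<close>. Used first to compare the coefficients of
    \<open>y\<close>, then those of \<open>x\<close>.\<close>
  have in_P: "r \<in> P" if "r *s z = w" "\<And>r'. z \<noteq> r' *s w" for r and z w :: "'a ^ 'n"
  proof (rule ccontr)
    assume "r \<notin> P"
    then obtain r' where "r' * r = 1" by (rule left_inverse_of_notin_P)
    then have "z = r' *s w" using that(1) by (auto simp: vector_smult_assoc)
    with that(2) show False by blast
  qed
  let ?g = "\<lambda>(a, b, d). a *s x + b *s y + d"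
  have "inj_on ?g (T \<times> T \<times> D)"
  proof (intro inj_onI, clarsimp)
    fix a b d a' b' d'
    assume mem: "a \<in> T" "b \<in> T" "d \<in> D" "a' \<in> T" "b' \<in> T" "d' \<in> D"
      and eq: "a *s x + b *s y + d = a' *s x + b' *s y + d'"
    have "(b - b') *s y = (a' - a) *s x + (d' - d)"
      using eq by (simp add: vec_eq_iff algebra_simps)
    moreover have "y \<noteq> r *s ((a' - a) *s x + (d' - d))" for r
      using y_neq[OF Dsm[OF Ddiff[OF mem(6,3)]], of "r * (a' - a)" r]
      by (simp add: vector_add_ldistrib vector_smult_assoc)
    ultimately have "b - b' \<in> P" by (rule in_P)
    with T(2) mem have b: "b = b'" by blast
    then have "(a - a') *s x = d' - d"
      using eq by (simp add: vec_eq_iff algebra_simps)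
    moreover have "x \<noteq> r *s (d' - d)" for r
      using x(2) Dsm[OF Ddiff[OF mem(6,3)]] by auto
    ultimately have "a - a' \<in> P" by (rule in_P)
    with T(2) mem have "a = a'" by blast
    with b eq show "a = a' \<and> b = b' \<and> d = d'" by simp
  qed
  moreover have "?g ` (T \<times> T \<times> D) \<subseteq> C" using x(1) y(1) DC Cadd Csm by auto
  ultimately have "card (T \<times> T \<times> D) \<le> card C" by (intro card_inj_on_le) auto
  then have "q\<^sup>2 * card D \<le> card C" using T(1) by (simp add: card_cartesian_product power2_eq_square)
  also have "card C = card D * card {c \<in> C. \<gamma> *s c = 0}"
    unfolding D_def
  proof (rule card_image_times_card_kernel)
    show "u - v \<in> C" if "u \<in> C" "v \<in> C" for u v
      using Cadd[OF that(1) Csm[OF that(2), of "-1"]] by (simp flip: vector_sneg_minus1)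
  qed (auto simp: vector_add_ldistrib)
  finally have "card D * q\<^sup>2 \<le> card D * card {c \<in> C. \<gamma> *s c = 0}" by (simp add: mult.commute)
  moreover have "card D > 0" using C0 by (auto simp: D_def card_gt_0_iff)
  ultimately show ?thesis by simp
qed

end

text \<open>The extremal case of the Singleton bound in dimension two and length \<open>q + 1\<close>.\<close>

lemma extremal_code:
  fixes S :: "('a::{ab_group_add, finite} ^ 'n) set"
  assumes diff: "\<And>x y. x \<in> S \<Longrightarrow> y \<in> S \<Longrightarrow> x - y \<in> S"
    and entries: "\<And>x i. x \<in> S \<Longrightarrow> x $ i \<in> A" and cardA: "card A \<le> q"
    and cardS: "q\<^sup>2 \<le> card S" and q: "0 < q" and n: "CARD('n) = q + 1"
    and zeros: "\<And>x i j. x \<in> S \<Longrightarrow> x $ i = 0 \<Longrightarrow> x $ j = 0 \<Longrightarrow> i \<noteq> j \<Longrightarrow> x = 0"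
  shows "(\<lambda>x. x $ i) ` S = A" and "x \<in> S \<Longrightarrow> \<exists>i. x $ i = 0"
proof -
  define K where "K i = {x \<in> S. x $ i = 0}" for i
  have S: "card S = card ((\<lambda>x. x $ i) ` S) * card (K i)" for i
    unfolding K_def by (rule card_image_times_card_kernel) (auto intro: diff)
  have im: "card ((\<lambda>x. x $ i) ` S) \<le> q" for i
    using cardA entries card_mono[of A "(\<lambda>x. x $ i) ` S"] by fastforce
  \<comment> \<open>A word vanishing at \<open>i\<close> is determined by its entry at any other
    position \<open>j\<close>, since a difference with two zeros is zero.\<close>
  have K_le: "card (K i) \<le> q" for i
  proof -
    have "card (UNIV - {i}) > 0" using n q by simp
    then obtain j where j: "i \<noteq> j" by (metis Diff_eq_empty_iff UNIV_I card.empty insertI1 less_irrefl singletonD subsetI)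
    have "inj_on (\<lambda>x. x $ j) (K i)"
    proof (rule inj_onI)
      fix x y assume "x \<in> K i" "y \<in> K i" "x $ j = y $ j"
      then show "x = y" using zeros[of "x - y" i j] diff j by (simp add: K_def)
    qed
    moreover have "(\<lambda>x. x $ j) ` K i \<subseteq> A" using entries by (auto simp: K_def)
    ultimately show ?thesis using card_inj_on_le[of "\<lambda>x. x $ j" "K i" A] cardA by simp
  qed
  \<comment> \<open>Two factors of at most \<open>q\<close> whose product is at least
    \<open>q\<^sup>2\<close> must both equal \<open>q\<close>.\<close>
  have im_eq: "card ((\<lambda>x. x $ i) ` S) = q" and K_eq: "card (K i) = q" for i
  proof -
    have *: "q * q \<le> card ((\<lambda>x. x $ i) ` S) * card (K i)"
      using S[of i] cardS by (simp add: power2_eq_square)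
    have "card ((\<lambda>x. x $ i) ` S) * card (K i) \<le> card ((\<lambda>x. x $ i) ` S) * q"
      using K_le by simp
    with * have "q * q \<le> card ((\<lambda>x. x $ i) ` S) * q" by (rule le_trans)
    with q have "q \<le> card ((\<lambda>x. x $ i) ` S)" by simp
    with im show "card ((\<lambda>x. x $ i) ` S) = q" by (rule le_antisym)
    with * q have "q \<le> card (K i)" by simp
    with K_le show "card (K i) = q" by (rule le_antisym)
  qed
  show "(\<lambda>x. x $ i) ` S = A"
    using entries im_eq cardA by (intro card_seteq) auto
  have "S \<noteq> {}" using cardS q by auto
  then have S0: "0 \<in> S" using diff by fastforce
  \<comment> \<open>The \<open>q + 1\<close> sets are disjoint and contain \<open>q - 1\<close>
    words each, which exhausts all \<open>q\<^sup>2 - 1\<close> nonzero words of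
    \<open>S\<close>.\<close>
  have "card (\<Union>i. K i - {0}) = (\<Sum>i\<in>UNIV. card (K i - {0}))"
    using zeros by (intro card_UN_disjoint) (auto simp: K_def)
  also have "\<dots> = (q + 1) * (q - 1)"
    using K_eq S0 n by (simp add: K_def)
  also have "\<dots> = q * q - 1" using q by (simp add: algebra_simps)
  also have "\<dots> = card (S - {0})"
    using S im_eq K_eq S0 by simp
  finally have "(\<Union>i. K i - {0}) = S - {0}"
    by (intro card_subset_eq) (auto simp: K_def)
  then show "\<exists>i. x $ i = 0" if "x \<in> S"
    using that by (cases "x = 0") (auto simp: K_def)
qed

section \<open>Weights of socle words and the contradictory codeword\<close>

theorem theorem20:
  fixes \<gamma> :: "'a::{ring_1, finite}"
    and s q :: nat
    and C :: "('a ^ 'n) set"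
  assumes "chain_ring TYPE('a)"
    and "chain_ring_generator \<gamma>"
    and "s = nilpotency_index \<gamma>"
    and "q = residue_card \<gamma>"
    and "CARD('n) = q + 1"
    and "MHD_code \<gamma> C"
    and "code_rank C = 2"
  shows "C \<subseteq> {x. \<forall>i. x $ i \<in> principal_ideal (\<gamma> ^ (s - 1))}"
proof (rule ccontr)
  interpret R: finite_chain_ring \<gamma>
    using assms(1,2) by unfold_locales
  assume "\<not> C \<subseteq> {x. \<forall>i. x $ i \<in> principal_ideal (\<gamma> ^ (s - 1))}"
  moreover have "{x. \<forall>i. x $ i \<in> principal_ideal (\<gamma> ^ (s - 1))} = {x :: 'a ^ 'n. \<gamma> *s x = 0}"
    unfolding assms(3) R.socle_iff by (simp add: vec_eq_iff)
  ultimately obtain c where c: "c \<in> C" "\<gamma> *s c \<noteq> 0" by blast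
  have q2: "2 \<le> q" using R.q_ge_2 assms(4) by simp
  have C: "linear_code C" "C \<noteq> {0}" using assms(6) by (auto simp: MHD_code_def)
  then have Cadd: "\<And>x y. x \<in> C \<Longrightarrow> y \<in> C \<Longrightarrow> x + y \<in> C"
    and Csm: "\<And>r x. x \<in> C \<Longrightarrow> r *s x \<in> C"
    by (auto simp: linear_code_def)
  have M: "hom_M \<gamma> = real q / (real q - 1)" "0 < hom_M \<gamma>"
    using q2 assms(4) by (auto simp: hom_M_def)
  have wt: "wt_Hom_elem \<gamma> x = (if x = 0 then 0 else if \<gamma> * x = 0 then hom_M \<gamma> else 1)" for x
    unfolding wt_Hom_elem_def R.socle_iff by (rule refl)
  \<comment> \<open>The factor \<open>q - 1\<close> is the length \<open>q + 1\<close> minus the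
    rank 2.\<close>
  have dist: "hom_M \<gamma> * (real q - 1) < wt_Hom \<gamma> x" if "x \<in> C" "x \<noteq> 0" for x
  proof -
    have "d_Hom \<gamma> C \<le> wt_Hom \<gamma> x"
      unfolding d_Hom_def using that by (intro Min_le) auto
    then show ?thesis using assms(5-7) by (simp add: MHD_code_def)
  qed

  define S where "S = {x \<in> C. \<gamma> *s x = 0}"
  have SC: "S \<subseteq> C" by (auto simp: S_def)
  have S_iff: "x \<in> S \<longleftrightarrow> x \<in> C \<and> (\<forall>i. \<gamma> * x $ i = 0)" for x
    by (simp add: S_def vec_eq_iff)
  \<comment> \<open>Two zeros leave \<open>q - 1\<close> positions, each of weight at most
    \<open>hom_M \<gamma>\<close>, too little for a nonzero codeword.\<close>
  have zeros: "x = 0" if x: "x \<in> S" "x $ i = 0" "x $ j = 0" "i \<noteq> j" for x i j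
  proof (rule ccontr)
    assume "x \<noteq> 0"
    have "wt_Hom \<gamma> x = (\<Sum>k\<in>UNIV - {i, j}. wt_Hom_elem \<gamma> (x $ k))"
      unfolding wt_Hom_def using x by (intro sum.mono_neutral_right) (auto simp: wt)
    also have "\<dots> \<le> (\<Sum>k\<in>UNIV - {i, j}. hom_M \<gamma>)"
      using x(1) M(2) by (intro sum_mono) (auto simp: wt S_iff)
    also have "\<dots> = hom_M \<gamma> * (real q - 1)"
      using x(4) assms(5) q2 by (simp add: card_Diff_subset of_nat_diff)
    finally show False using dist[of x] \<open>x \<noteq> 0\<close> x(1) SC by auto
  qed
  have Sdiff: "x - y \<in> S" if "x \<in> S" "y \<in> S" for x y
    using that Cadd[OF _ Csm[of y "-1"], of x]
    by (simp add: S_iff right_diff_distrib flip: vector_sneg_minus1)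
  have entries: "x $ i \<in> {z. \<gamma> * z = 0}" if "x \<in> S" for x i
    using that by (simp add: S_iff)
  have cardA: "card {z. \<gamma> * z = 0} \<le> q"
    using R.card_socle_le assms(4) by simp
  have cardS: "q\<^sup>2 \<le> card S"
    unfolding S_def assms(4) by (rule R.card_kernel_ge[OF C assms(7)])
  have "0 < q" using q2 by simp
  have onto: "(\<lambda>x. x $ i) ` S = {z. \<gamma> * z = 0}" for i
    by (rule extremal_code(1); fact Sdiff entries cardA cardS \<open>0 < q\<close> assms(5) zeros)
  have has_zero: "\<exists>i. x $ i = 0" if "x \<in> S" for x
    by (rule extremal_code(2)[where S = S]; fact that Sdiff entries cardA cardS \<open>0 < q\<close> assms(5) zeros)

  \<comment> \<open>Stop just before the powers of \<gamma> kill \<open>c\<close>. The word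
    \<open>e\<close> below is \<open>\<gamma> ^ k *s c\<close>.\<close>
  obtain k where "\<gamma> ^ Suc k *s c \<noteq> 0" "\<gamma> ^ Suc (Suc k) *s c = 0"
  proof -
    have "\<exists>k. \<gamma> ^ Suc k *s c \<noteq> 0 \<and> \<gamma> ^ Suc (Suc k) *s c = 0" if "\<gamma> ^ Suc n *s c = 0" for n
      using that by (induction n) (use c(2) in auto)
    moreover have "\<gamma> ^ Suc R.s *s c = 0" by (simp add: R.power_s)
    ultimately show thesis using that by blast
  qed
  then obtain e where e: "e \<in> C" "\<gamma> *s e \<noteq> 0" "\<gamma> *s (\<gamma> *s e) = 0"
    using Csm[OF c(1), of "\<gamma> ^ k"] by (metis vector_smult_assoc power_Suc)
  then have u: "\<gamma> *s e \<in> S" using Csm by (simp add: S_def)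
  then obtain i where i: "\<gamma> * e $ i = 0"
    using has_zero[OF u] by auto
  have nz: "\<gamma> * e $ j \<noteq> 0" if "j \<noteq> i" for j
    using zeros[OF u, of i j] i e(2) that by auto
  obtain v where v: "v \<in> S" "v $ i = - e $ i"
  proof -
    have "- e $ i \<in> (\<lambda>x. x $ i) ` S" using onto i by simp
    then show thesis using that by auto
  qed
  \<comment> \<open>Adding \<open>v\<close> clears position \<open>i\<close> and, as \<gamma> kills
    \<open>v\<close>, leaves \<open>\<gamma> *s e\<close> unchanged. Hence all other entries stay
    outside the socle and weigh 1.\<close>
  define w where "w = e + v"
  have w: "w $ i = 0" "\<gamma> * w $ j = \<gamma> * e $ j" for j
    using v by (auto simp: w_def S_iff distrib_left)
  have "wt_Hom \<gamma> w = (\<Sum>j\<in>UNIV - {i}. wt_Hom_elem \<gamma> (w $ j))"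
    unfolding wt_Hom_def using w(1) by (intro sum.mono_neutral_right) (auto simp: wt)
  also have "\<dots> = (\<Sum>j\<in>UNIV - {i}. 1)"
  proof (rule sum.cong)
    fix j assume "j \<in> UNIV - {i}"
    then have "\<gamma> * w $ j \<noteq> 0" using nz w(2) by simp
    then show "wt_Hom_elem \<gamma> (w $ j) = 1" by (auto simp: wt)
  qed simp
  also have "\<dots> = real q" using assms(5) by simp
  \<comment> \<open>The weight meets the bound exactly, so the contradiction comes from the strict
    inequality in \<open>dist\<close>.\<close>
  also have "\<dots> = hom_M \<gamma> * (real q - 1)" using M(1) q2 by simp
  finally have "\<not> hom_M \<gamma> * (real q - 1) < wt_Hom \<gamma> w" by simp
  moreover have "w \<in> C" using e(1) v(1) Cadd SC by (auto simp: w_def)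
  moreover have "w \<noteq> 0" using w(2) e(2) by (auto simp: vec_eq_iff) (metis mult_zero_right)
  ultimately show False using dist by blast
qed

end
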